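(* Let $m,n,k,l$ be positive integers with $km=nl$, so that the class $\mathcal{A}(m,n;k,l)$ is nonempty, and let $t$ be a positive integer. Then \[\rho_t(A)=\min\{tm,n\}\quad\text{for all } A\in \mathcal{A}(m,n;k,l).\]
   Context: $\mathcal{A}(m,n;k,l)$ denotes the class of all $m\times n$ $(0,1)$-matrices with exactly $k$ $1$s in each row and exactly $l$ $1$s in each column. For a $(0,1)$-matrix $A$ and positive integer $t$, the $t$-term rank $\rho_t(A)$ is the maximum number of $1$s of $A$ that can be chosen with at most one chosen $1$ in each column and at most $t$ chosen $1$s in each row. *)

theory Defs
  imports "Jordan_Normal_Form.Matrix"
begin

definition zero_one_class :: "nat \<Rightarrow> nat \<Rightarrow> nat \<Rightarrow> nat \<Rightarrow> 'a::zero_neq_one mat set" where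
  "zero_one_class m n k l =
     {A \<in> carrier_mat m n.
        (\<forall>i<m. \<forall>j<n. A $$ (i, j) \<in> {0, 1}) \<and>
        (\<forall>i<m. card {j. j < n \<and> A $$ (i, j) = 1} = k) \<and>
        (\<forall>j<n. card {i. i < m \<and> A $$ (i, j) = 1} = l)}"

definition one_positions :: "'a::zero_neq_one mat \<Rightarrow> (nat \<times> nat) set" where
  "one_positions A = {(i, j). i < dim_row A \<and> j < dim_col A \<and> A $$ (i, j) = 1}"

definition t_admissible :: "nat \<Rightarrow> 'a::zero_neq_one mat \<Rightarrow> (nat \<times> nat) set \<Rightarrow> bool" where
  "t_admissible t A S \<longleftrightarrow>
     S \<subseteq> one_positions A \<and>
     (\<forall>j<dim_col A. card {i. (i, j) \<in> S} \<le> 1) \<and>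
     (\<forall>i<dim_row A. card {j. (i, j) \<in> S} \<le> t)"

definition t_term_rank :: "nat \<Rightarrow> 'a::zero_neq_one mat \<Rightarrow> nat" where
  "t_term_rank t A = Max {card S |S. t_admissible t A S}"

lemma finite_one_positions: "finite (one_positions A)"
  by (rule finite_subset[of _ "{..<dim_row A} \<times> {..<dim_col A}"]) (auto simp: one_positions_def)

text \<open>The maximum is over a finite nonempty set, and all cardinalities are of finite sets.\<close>

lemma finite_t_admissible:
  assumes "t_admissible t A S"
  shows "finite S"
  using assms finite_one_positions finite_subset unfolding t_admissible_def by blast

lemma finite_t_admissible_cards: "finite {card S |S. t_admissible t A S}"
proof -
  have "{card S |S. t_admissible t A S} \<subseteq> card ` Pow (one_positions A)"
    by (auto simp: t_admissible_def)
  then show ?thesis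
    using finite_one_positions finite_subset by blast
qed

lemma t_admissible_empty: "t_admissible t A {}"
  by (simp add: t_admissible_def)

end

(* A choice of n ones realising t_term_rank = n assigns to every column one of t slots of a row in
   which it has a 1; a choice of t * m ones assigns to every slot (row, copy) its own column. Both
   are systems of distinct representatives, and since each row has k ones and each column l ones,
   Hall's condition reduces by double counting to k <= t * l or t * l <= k respectively. With
   k * m = n * l these are the cases n <= t * m and t * m <= n. *)
theory Submission
  imports Defs
begin

text \<open>The proof of Halmos and Vaughan: split the index set at a tight proper subfamily if there is
  one, and otherwise choose one representative freely.\<close>

theorem hall_distinct_representatives:
  fixes A :: "'i \<Rightarrow> 'a set"
  assumes "finite I"
    and "\<And>i. i \<in> I \<Longrightarrow> finite (A i)"
    and "\<And>J. J \<subseteq> I \<Longrightarrow> card J \<le> card (\<Union>(A ` J))"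
  shows "\<exists>f. inj_on f I \<and> (\<forall>i\<in>I. f i \<in> A i)"
  using assms
proof (induction I arbitrary: A rule: finite_psubset_induct)
  case (psubset I)
  note fin = psubset.prems(1) and hall = psubset.prems(2)
  \<comment> \<open>Hall's condition turns the inequality in the second case into an equality, so
    such a \<open>J\<close> is tight: its representatives must use up all of
    \<open>?U\<close>.\<close>
  consider "I = {}"
    | J where "J \<subset> I" "J \<noteq> {}" "card (\<Union>(A ` J)) \<le> card J"
    | "I \<noteq> {}" "\<And>J. J \<subset> I \<Longrightarrow> J \<noteq> {} \<Longrightarrow> card J < card (\<Union>(A ` J))"
    by (meson not_le)
  then show ?case
  proof cases
    case 1
    then show ?thesis by simp
  next
    case (2 J)
    let ?U = "\<Union>(A ` J)"
    have "\<exists>f. inj_on f J \<and> (\<forall>i\<in>J. f i \<in> A i)"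
      using 2 fin hall by (intro psubset.IH) auto
    then obtain f where f: "inj_on f J" "\<And>i. i \<in> J \<Longrightarrow> f i \<in> A i" by blast
    \<comment> \<open>Removing \<open>?U\<close> from the remaining sets keeps the values of
      \<open>g\<close> apart from those of \<open>f\<close>, which all lie in
      \<open>?U\<close>.\<close>
    have "\<exists>g. inj_on g (I - J) \<and> (\<forall>i\<in>I - J. g i \<in> A i - ?U)"
    proof (rule psubset.IH)
      show "I - J \<subset> I" using 2 by blast
      show "finite (A i - ?U)" if "i \<in> I - J" for i using that fin by blast
      show "card K \<le> card (\<Union>i\<in>K. A i - ?U)" if "K \<subseteq> I - J" for K
      proof -
        have sub: "J \<union> K \<subseteq> I" using that 2 by blast
        have "finite J" "finite K" "J \<inter> K = {}"
          using sub that finite_subset \<open>finite I\<close> by auto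
        \<comment> \<open>Hall's condition is used for \<open>J \<union> K\<close>, not for
          \<open>K\<close> alone: as \<open>?U\<close> accounts for at most \<open>card J\<close>
          elements of the union, at least \<open>card K\<close> are left outside
          \<open>?U\<close>.\<close>
        then have "card J + card K = card (J \<union> K)" by (simp add: card_Un_disjoint)
        also have "\<dots> \<le> card (\<Union>(A ` (J \<union> K)))" using hall sub by blast
        also have "\<Union>(A ` (J \<union> K)) = ?U \<union> (\<Union>i\<in>K. A i - ?U)" by auto
        also have "card \<dots> \<le> card ?U + card (\<Union>i\<in>K. A i - ?U)" by (rule card_Un_le)
        finally show ?thesis using 2 by linarith
      qed
    qed
    then obtain g where g: "inj_on g (I - J)" "\<And>i. i \<in> I - J \<Longrightarrow> g i \<in> A i - ?U" by blast
    let ?h = "\<lambda>i. if i \<in> J then f i else g i"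
    have "inj_on ?h I"
    proof (rule inj_onI)
      fix x y assume xy: "x \<in> I" "y \<in> I" "?h x = ?h y"
      show "x = y"
      proof (cases "x \<in> J"; cases "y \<in> J")
        assume "x \<in> J" "y \<in> J"
        then show ?thesis using xy f(1) by (simp add: inj_on_eq_iff)
      next
        assume "x \<in> J" "y \<notin> J"
        then show ?thesis using xy f(2)[of x] g(2)[of y] by auto
      next
        assume "x \<notin> J" "y \<in> J"
        then show ?thesis using xy f(2)[of y] g(2)[of x] by auto
      next
        assume "x \<notin> J" "y \<notin> J"
        then show ?thesis using xy g(1) by (simp add: inj_on_eq_iff)
      qed
    qed
    moreover have "\<forall>i\<in>I. ?h i \<in> A i" using f(2) g(2) by auto
    ultimately show ?thesis by blast
  next
    case 3
    then obtain i where i: "i \<in> I" by blast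
    have "card {i} \<le> card (A i)" using hall[of "{i}"] i by simp
    then obtain x where x: "x \<in> A i" by fastforce
    have "\<exists>f. inj_on f (I - {i}) \<and> (\<forall>j\<in>I - {i}. f j \<in> A j - {x})"
    proof (rule psubset.IH)
      show "I - {i} \<subset> I" using i by blast
      show "finite (A j - {x})" if "j \<in> I - {i}" for j using that fin by blast
      show "card J \<le> card (\<Union>j\<in>J. A j - {x})" if "J \<subseteq> I - {i}" for J
      proof (cases "J = {}")
        case False
        have sub: "J \<subset> I" using that i by blast
        \<comment> \<open>No proper nonempty subfamily is tight, so each has one element to spare,
          which pays for the deletion of \<open>x\<close>.\<close>
        have "card J \<le> card (\<Union>(A ` J)) - 1" using 3(2)[OF sub False] by simp
        also have "\<dots> \<le> card (\<Union>(A ` J) - {x})"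
          using diff_card_le_card_Diff[of "{x}" "\<Union>(A ` J)"] by simp
        also have "\<Union>(A ` J) - {x} = (\<Union>j\<in>J. A j - {x})" by blast
        finally show ?thesis .
      qed simp
    qed
    then obtain f where f: "inj_on f (I - {i})" "\<And>j. j \<in> I - {i} \<Longrightarrow> f j \<in> A j - {x}" by blast
    have "inj_on (f(i := x)) (insert i (I - {i}))"
      using f by (auto simp: inj_on_def)
    moreover have "insert i (I - {i}) = I" using i by blast
    moreover have "\<forall>j\<in>I. (f(i := x)) j \<in> A j" using f(2) x by auto
    ultimately show ?thesis by metis
  qed
qed

text \<open>Double counting of the related pairs with first component in \<open>Z\<close>: each
  \<open>x\<close> in \<open>Z\<close> lies in exactly \<open>a\<close> of them, and each neighbour
  \<open>y\<close> in at most \<open>b\<close>, since only part of its \<open>b\<close> partners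
  need lie in \<open>Z\<close>. This supplies Hall's condition for both constructions below.\<close>

lemma biregular_expansion:
  assumes "finite X" "finite Y" "Z \<subseteq> X"
    and deg_X: "\<And>x. x \<in> X \<Longrightarrow> card {y \<in> Y. R x y} = a"
    and deg_Y: "\<And>y. y \<in> Y \<Longrightarrow> card {x \<in> X. R x y} = b"
  shows "a * card Z \<le> b * card (\<Union>x\<in>Z. {y \<in> Y. R x y})"
proof -
  let ?N = "\<Union>x\<in>Z. {y \<in> Y. R x y}"
  have fin: "finite Z" "finite ?N"
    using assms(1-3) finite_subset by (blast, auto intro: finite_subset[OF _ assms(2)])
  have "a * card Z = (\<Sum>x\<in>Z. card {y \<in> Y. R x y})"
    using assms(3) deg_X by (simp add: subset_iff)
  also have "\<dots> = (\<Sum>x\<in>Z. card {y \<in> ?N. R x y})"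
    by (intro sum.cong arg_cong[of _ _ card]) auto
  also have "\<dots> = (\<Sum>y\<in>?N. card {x \<in> Z. R x y})"
    using fin by (intro sum_multicount_gen) auto
  also have "\<dots> \<le> (\<Sum>y\<in>?N. b)"
  proof (rule sum_mono)
    fix y assume "y \<in> ?N"
    then have "card {x \<in> X. R x y} = b" using deg_Y by blast
    moreover have "card {x \<in> Z. R x y} \<le> card {x \<in> X. R x y}"
      using assms(1,3) by (intro card_mono) auto
    ultimately show "card {x \<in> Z. R x y} \<le> b" by simp
  qed
  finally show ?thesis by (simp add: mult.commute)
qed

lemma t_admissible_card_le:
  assumes "t_admissible t A S"
  shows "card S \<le> min (t * dim_row A) (dim_col A)"
proof -
  have S: "i < dim_row A" "j < dim_col A" if "(i, j) \<in> S" for i j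
    using assms that by (auto simp: t_admissible_def one_positions_def)
  have fin: "finite S" using assms by (rule finite_t_admissible)
  have rows: "S = (SIGMA i:{..<dim_row A}. {j. (i, j) \<in> S})" using S by auto
  \<comment> \<open>Swapping the coordinates lets the same count run over columns.\<close>
  have cols: "prod.swap ` S = (SIGMA j:{..<dim_col A}. {i. (i, j) \<in> S})" using S by force
  have fin_row: "finite {j. (i, j) \<in> S}" for i
    by (rule finite_subset[of _ "snd ` S"]) (use fin in force)+
  have fin_col: "finite {i. (i, j) \<in> S}" for j
    by (rule finite_subset[of _ "fst ` S"]) (use fin in force)+
  have "card S = (\<Sum>i<dim_row A. card {j. (i, j) \<in> S})"
    using fin_row by (subst rows) (simp add: card_SigmaI)
  also have "\<dots> \<le> (\<Sum>i<dim_row A. t)"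
    using assms by (intro sum_mono) (auto simp: t_admissible_def)
  finally have 1: "card S \<le> t * dim_row A" by (simp add: mult.commute)
  have "card S = card (prod.swap ` S)" by (simp add: card_image)
  also have "\<dots> = (\<Sum>j<dim_col A. card {i. (i, j) \<in> S})"
    using fin_col by (subst cols) (simp add: card_SigmaI)
  also have "\<dots> \<le> (\<Sum>j<dim_col A. 1)"
    using assms by (intro sum_mono) (auto simp: t_admissible_def)
  finally show ?thesis using 1 by simp
qed

context
  fixes m n k l :: nat and A :: "'a::zero_neq_one mat"
  assumes A: "A \<in> zero_one_class m n k l"
begin

lemma zero_one_class_dims: "dim_row A = m" "dim_col A = n"
  using A by (auto simp: zero_one_class_def)

lemma zero_one_class_row: "i < m \<Longrightarrow> card {j \<in> {..<n}. A $$ (i, j) = 1} = k"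
  using A by (simp add: zero_one_class_def)

lemma zero_one_class_col: "j < n \<Longrightarrow> card {i \<in> {..<m}. A $$ (i, j) = 1} = l"
  using A by (simp add: zero_one_class_def)

lemma ex_t_admissible_saturating_columns:
  assumes "l > 0" "k \<le> t * l"
  shows "\<exists>S. t_admissible t A S \<and> card S = n"
proof -
  define N where "N j = {i \<in> {..<m}. A $$ (i, j) = 1}" for j
  have "\<exists>f. inj_on f {..<n} \<and> (\<forall>j\<in>{..<n}. f j \<in> N j \<times> {..<t})"
  proof (rule hall_distinct_representatives)
    show "finite (N j \<times> {..<t})" for j by (simp add: N_def)
    fix J assume "J \<subseteq> {..<n}"
    then have "l * card J \<le> k * card (\<Union>(N ` J))"
      unfolding N_def
      by (intro biregular_expansion[where X = "{..<n}"])
        (simp_all add: zero_one_class_row[simplified] zero_one_class_col[simplified])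
    \<comment> \<open>The hypothesis \<open>k \<le> t * l\<close> trades the factor \<open>k\<close>
      for \<open>t\<close> slots per row and a factor \<open>l\<close> that cancels.\<close>
    also have "\<dots> \<le> l * (card (\<Union>(N ` J)) * t)"
      using assms(2) by (simp add: mult.commute mult.left_commute)
    finally have "card J \<le> card (\<Union>(N ` J)) * t" using assms(1) by simp
    also have "\<dots> = card (\<Union>(N ` J) \<times> {..<t})" by (simp add: card_cartesian_product)
    also have "\<Union>(N ` J) \<times> {..<t} = (\<Union>j\<in>J. N j \<times> {..<t})" by blast
    finally show "card J \<le> card (\<Union>j\<in>J. N j \<times> {..<t})" .
  qed simp
  then obtain f where f: "inj_on f {..<n}" "\<And>j. j < n \<Longrightarrow> f j \<in> N j \<times> {..<t}"
    by auto
  define S where "S = (\<lambda>j. (fst (f j), j)) ` {..<n}"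
  have row: "card {j. (i, j) \<in> S} \<le> t" for i
  proof -
    \<comment> \<open>Columns served by the same row \<open>i\<close> agree in the first component
      of \<open>f\<close>, so injectivity of \<open>f\<close> forces their slots to differ; there
      are only \<open>t\<close> slots.\<close>
    have "inj_on (\<lambda>j. snd (f j)) {j. (i, j) \<in> S}"
    proof (rule inj_onI)
      fix x y assume "x \<in> {j. (i, j) \<in> S}" "y \<in> {j. (i, j) \<in> S}" "snd (f x) = snd (f y)"
      then have "x < n" "y < n" "f x = f y" by (auto simp: S_def prod_eq_iff)
      then show "x = y" using f(1) by (simp add: inj_on_eq_iff)
    qed
    moreover have "(\<lambda>j. snd (f j)) ` {j. (i, j) \<in> S} \<subseteq> {..<t}"
      using f(2) by (force simp: S_def mem_Times_iff)
    ultimately have "card {j. (i, j) \<in> S} \<le> card {..<t}"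
      by (rule card_inj_on_le) simp
    then show ?thesis by simp
  qed
  have "card {i. (i, j) \<in> S} \<le> card {fst (f j)}" for j
    by (rule card_mono) (auto simp: S_def)
  then have "t_admissible t A S"
    using row f(2)
    by (auto simp: t_admissible_def one_positions_def zero_one_class_dims S_def N_def mem_Times_iff)
  moreover have "card S = n"
    unfolding S_def by (simp add: card_image inj_on_def)
  ultimately show ?thesis by blast
qed

lemma ex_t_admissible_saturating_rows:
  assumes "l > 0" "t * l \<le> k"
  shows "\<exists>S. t_admissible t A S \<and> card S = t * m"
proof -
  define N where "N i = {j \<in> {..<n}. A $$ (i, j) = 1}" for i
  define I where "I = {..<m} \<times> {..<t}"
  have "\<exists>f. inj_on f I \<and> (\<forall>p\<in>I. f p \<in> N (fst p))"
  proof (rule hall_distinct_representatives)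
    show "finite I" by (simp add: I_def)
    show "finite (N (fst p))" for p :: "nat \<times> nat" by (simp add: N_def)
    fix J assume J: "J \<subseteq> I"
    let ?R = "fst ` J"
    have R: "?R \<subseteq> {..<m}" using J by (auto simp: I_def)
    \<comment> \<open>All slots of a row share the same candidate columns, so Hall's condition
      depends on \<open>J\<close> only through its rows \<open>?R\<close>, each of which carries at
      most \<open>t\<close> elements of \<open>J\<close>.\<close>
    have "J \<subseteq> ?R \<times> {..<t}" using J by (auto simp: I_def intro: image_eqI[rotated])
    moreover have "finite (?R \<times> {..<t})" using R finite_subset by blast
    ultimately have "card J \<le> card (?R \<times> {..<t})" by (intro card_mono)
    also have "\<dots> = t * card ?R" by (simp add: card_cartesian_product)
    finally have "l * card J \<le> (t * l) * card ?R"
      by (metis mult.assoc mult.commute mult_le_mono2)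
    also have "\<dots> \<le> k * card ?R" using assms(2) by simp
    also have "\<dots> \<le> l * card (\<Union>(N ` ?R))"
      unfolding N_def using R
      by (intro biregular_expansion[where X = "{..<m}"])
        (simp_all add: zero_one_class_row[simplified] zero_one_class_col[simplified])
    finally show "card J \<le> card (\<Union>p\<in>J. N (fst p))"
      using assms(1) by (simp add: image_image)
  qed
  then obtain f where f: "inj_on f I" "\<And>p. p \<in> I \<Longrightarrow> f p \<in> N (fst p)"
    by auto
  define S where "S = (\<lambda>p. (fst p, f p)) ` I"
  have row: "card {j. (i, j) \<in> S} \<le> t" for i
  proof -
    have "{j. (i, j) \<in> S} \<subseteq> (\<lambda>s. f (i, s)) ` {..<t}"
      by (auto simp: S_def I_def)
    then have "card {j. (i, j) \<in> S} \<le> card {..<t}"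
      by (rule surj_card_le[rotated]) simp
    then show ?thesis by simp
  qed
  have "card {i. (i, j) \<in> S} \<le> 1" for j
  \<comment> \<open>Two entries of \<open>S\<close> in column \<open>j\<close> come from slots with
    the same value \<open>j\<close> of \<open>f\<close>; these slots coincide, and so do their
    rows.\<close>
  proof (rule card_le_Suc0_iff_eq[THEN iffD2, folded One_nat_def])
    show "finite {i. (i, j) \<in> S}"
      by (rule finite_subset[of _ "{..<m}"]) (auto simp: S_def I_def)
    show "\<forall>x\<in>{i. (i, j) \<in> S}. \<forall>y\<in>{i. (i, j) \<in> S}. x = y"
      using f(1) by (auto simp: S_def dest: inj_onD)
  qed
  then have "t_admissible t A S"
    using row f(2)
    by (force simp: t_admissible_def one_positions_def zero_one_class_dims S_def I_def N_def)
  moreover have "inj_on (\<lambda>p. (fst p, f p)) I" using f(1) by (simp add: inj_on_def)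
  then have "card S = t * m"
    unfolding S_def by (simp add: card_image I_def card_cartesian_product)
  ultimately show ?thesis by blast
qed

end

theorem theorem3p1:
  fixes m n k l t :: nat
  assumes "m > 0" and "n > 0" and "k > 0" and "l > 0"
    and "k * m = n * l"
    and "t > 0"
  shows "\<forall>A \<in> (zero_one_class m n k l :: 'a::zero_neq_one mat set).
           t_term_rank t A = min (t * m) n"
proof
  fix A :: "'a mat" assume A: "A \<in> zero_one_class m n k l"
  have "\<exists>S. t_admissible t A S \<and> card S = min (t * m) n"
  proof (cases "n \<le> t * m")
    case True
    \<comment> \<open>Multiplying \<open>n \<le> t * m\<close> by \<open>l\<close> and replacing
      \<open>n * l\<close> by \<open>k * m\<close> leaves a common factor \<open>m > 0\<close>; the
      other case reverses the inequality.\<close>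
    then have "k * m \<le> t * l * m"
      using mult_le_mono1[OF True, of l] assms(5) by (simp add: mult.commute mult.left_commute)
    then have "k \<le> t * l" using assms(1) by simp
    then show ?thesis
      using ex_t_admissible_saturating_columns[OF A assms(4)] True by (simp add: min_def)
  next
    case False
    then have "t * l * m \<le> k * m"
      using mult_le_mono1[of "t * m" n l] assms(5) by (simp add: mult.commute mult.left_commute)
    then have "t * l \<le> k" using assms(1) by simp
    then show ?thesis
      using ex_t_admissible_saturating_rows[OF A assms(4)] False by (simp add: min_def)
  qed
  moreover have "card S \<le> min (t * m) n" if "t_admissible t A S" for S
    using t_admissible_card_le[OF that] zero_one_class_dims[OF A] by simp
  ultimately show "t_term_rank t A = min (t * m) n"
    unfolding t_term_rank_def by (intro Max_eqI finite_t_admissible_cards) (blast, metis (mono_tags, lifting) mem_Collect_eq)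
qed

end
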